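(* For every positive integer $N$, writing $[N]=\{1,2,\ldots,N\}\subset\mathbb{Z}$, \[ d_s([N])=d_d^-([N])=\lfloor\log_3 N\rfloor+\big\lceil \log_3 2N-\lfloor\log_3 N\rfloor\big\rceil. \]
   Context: $[N]$ is viewed as an additive set in $\mathbb{Z}$. A set $D$ is dissociated if its subset sums are pairwise distinct (equivalently, the only combination $\sum_{x\in D}\varepsilon_x x$ with $\varepsilon_x\in\{-1,0,1\}$ equal to $0$ is the trivial one); $D\subset A$ is maximal dissociated in $A$ if no dissociated $D'\subset A$ strictly contains $D$; $d_d^-(A)=\min\{|D|:D\subset A\text{ maximal dissociated}\}$. The 1-span $\langle S\rangle$ is the set of all sums $\sum_{s\in S}\varepsilon_s s$ with $\varepsilon_s\in\{-1,0,1\}$, and $d_s(A)=\min\{|S|:S\subset A,\ \langle S\rangle\supset A\}$. *)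

theory Defs
  imports Complex_Main
begin

text \<open>
  Additive sets are finite, so everything below is meant for finite sets of integers only:
  on infinite sets \<open>card\<close> and \<open>\<Sum>\<close> return the default value 0.
\<close>

definition dissociated :: "int set \<Rightarrow> bool" where
  "dissociated D \<longleftrightarrow> inj_on (\<lambda>X. \<Sum>x\<in>X. x) (Pow D)"

definition maximal_dissociated :: "int set \<Rightarrow> int set \<Rightarrow> bool" where
  "maximal_dissociated A D \<longleftrightarrow>
     D \<subseteq> A \<and> dissociated D \<and> \<not> (\<exists>D'. D' \<subseteq> A \<and> dissociated D' \<and> D \<subset> D')"

definition one_span :: "int set \<Rightarrow> int set" where
  "one_span S = {\<Sum>s\<in>S. \<epsilon> s * s | \<epsilon>. \<forall>s\<in>S. \<epsilon> s \<in> {-1, 0, 1::int}}"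

text \<open>
  For finite \<open>A\<close> both infima are taken over nonempty sets of naturals, hence are minima:
  the empty set is dissociated and extends to a maximal dissociated subset of \<open>A\<close>,
  and \<open>A\<close> is contained in its own 1-span.
\<close>

definition d_d_minus :: "int set \<Rightarrow> nat" where
  "d_d_minus A = Inf {card D | D. maximal_dissociated A D}"

definition d_s :: "int set \<Rightarrow> nat" where
  "d_s A = Inf {card S | S. S \<subseteq> A \<and> A \<subseteq> one_span S}"

end

theory Submission
  imports Defs
begin

text \<open>
  A subset of \<open>[N]\<close> with \<open>k\<close> elements has a symmetric 1-span of at most \<open>3 ^ k\<close> elements, so if it spans
  \<open>[N]\<close> then \<open>2 * N + 1 \<le> 3 ^ k\<close>. An element outside the 1-span of a dissociated set can be adjoined
  to it, so maximal dissociated sets are spanning and \<open>d_s \<le> d_d_minus\<close>. Conversely, if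
  \<open>3 ^ n < 2 * N \<le> 3 ^ (n + 1)\<close>, then \<open>1, 3, \<dots>, 3 ^ (n - 1)\<close> together with \<open>min N (3 ^ n)\<close> is a
  dissociated set of \<open>n + 1\<close> elements spanning \<open>[N]\<close>: balanced ternary gives the interval
  \<open>[-M, M]\<close> with \<open>2 * M + 1 = 3 ^ n\<close>, and the last element lies in \<open>(M, 2 * M + 1]\<close>, so that the
  translates of this interval overlap or abut.
\<close>

text \<open>Grouping the terms by the sign of their coefficient gives \<open>Y\<close> and
  \<open>X\<close>. This form ties the 1-span to subset sums, in terms of which
  \<open>dissociated\<close> is stated.\<close>

lemma one_span_eq_diff_subset_sums:
  assumes "finite S"
  shows "one_span S = {\<Sum>Y - \<Sum>X | X Y. X \<subseteq> S \<and> Y \<subseteq> S}"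
proof (intro set_eqI iffI)
  fix z assume "z \<in> one_span S"
  then obtain \<epsilon> where z: "z = (\<Sum>s\<in>S. \<epsilon> s * s)" and \<epsilon>: "\<And>s. s \<in> S \<Longrightarrow> \<epsilon> s \<in> {-1, 0, 1::int}"
    unfolding one_span_def by blast
  let ?Y = "{s \<in> S. \<epsilon> s = 1}" and ?X = "{s \<in> S. \<epsilon> s = -1}"
  have "z = (\<Sum>s\<in>S. (if \<epsilon> s = 1 then s else 0) - (if \<epsilon> s = -1 then s else 0))"
    unfolding z using \<epsilon> by (intro sum.cong) auto
  also have "\<dots> = \<Sum>?Y - \<Sum>?X"
    using assms by (simp add: sum_subtractf sum.inter_filter)
  finally show "z \<in> {\<Sum>Y - \<Sum>X | X Y. X \<subseteq> S \<and> Y \<subseteq> S}" by blast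
next
  fix z assume "z \<in> {\<Sum>Y - \<Sum>X | X Y. X \<subseteq> S \<and> Y \<subseteq> S}"
  then obtain X Y where z: "z = \<Sum>Y - \<Sum>X" and XY: "X \<subseteq> S" "Y \<subseteq> S" by blast
  \<comment> \<open>\<open>X\<close> and \<open>Y\<close> may overlap: a common element gets
    coefficient 0, so the values stay in {-1, 0, 1}.\<close>
  let ?\<epsilon> = "\<lambda>s. of_bool (s \<in> Y) - of_bool (s \<in> X) :: int"
  have "(\<Sum>s\<in>S. ?\<epsilon> s * s) = (\<Sum>s\<in>S. (if s \<in> Y then s else 0) - (if s \<in> X then s else 0))"
    by (intro sum.cong) auto
  also have "\<dots> = \<Sum>(S \<inter> Y) - \<Sum>(S \<inter> X)"
    using assms by (simp add: sum_subtractf sum.inter_restrict)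
  also have "\<dots> = z" using XY by (simp add: z Int_absorb1)
  finally show "z \<in> one_span S"
    unfolding one_span_def by (intro CollectI exI[of _ ?\<epsilon>]) auto
qed

lemma one_span_uminus:
  assumes "finite S" "z \<in> one_span S"
  shows "- z \<in> one_span S"
  using assms by (force simp: one_span_eq_diff_subset_sums)

lemma zero_in_one_span: "0 \<in> one_span S"
  unfolding one_span_def by (intro CollectI exI[of _ "\<lambda>_. 0"]) auto

lemma subset_one_span:
  assumes "finite S"
  shows "S \<subseteq> one_span S"
proof
  fix x assume "x \<in> S"
  then have "x = \<Sum>{x} - \<Sum>{}" "{x} \<subseteq> S" "{} \<subseteq> S" by auto
  then show "x \<in> one_span S"
    unfolding one_span_eq_diff_subset_sums[OF assms] by blast
qed

lemma one_span_empty: "one_span {} = {0}"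
  by (auto simp: one_span_def)

text \<open>Sort the signed sums by the coefficient of \<open>x\<close>. Both the cardinality bound
  and the interval computation rest on this recursion.\<close>

lemma one_span_insert:
  assumes "finite S" "x \<notin> S"
  shows "one_span (insert x S) =
    one_span S \<union> (\<lambda>y. x + y) ` one_span S \<union> (\<lambda>y. y - x) ` one_span S"
proof (intro set_eqI iffI)
  fix z assume "z \<in> one_span (insert x S)"
  then obtain \<epsilon> where z: "z = (\<Sum>s\<in>insert x S. \<epsilon> s * s)"
    and \<epsilon>: "\<forall>s\<in>insert x S. \<epsilon> s \<in> {-1, 0, 1::int}"
    unfolding one_span_def by blast
  let ?y = "\<Sum>s\<in>S. \<epsilon> s * s"
  have "z = \<epsilon> x * x + ?y" using assms by (simp add: z)
  moreover have "?y \<in> one_span S" unfolding one_span_def using \<epsilon> by blast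
  moreover have "\<epsilon> x = -1 \<or> \<epsilon> x = 0 \<or> \<epsilon> x = 1" using \<epsilon> by blast
  ultimately show "z \<in> one_span S \<union> (\<lambda>y. x + y) ` one_span S \<union> (\<lambda>y. y - x) ` one_span S"
    by (auto simp: image_iff)
next
  have step: "e * x + y \<in> one_span (insert x S)" if "y \<in> one_span S" and e: "e \<in> {-1, 0, 1}" for e y
  proof -
    obtain \<epsilon> where y: "y = (\<Sum>s\<in>S. \<epsilon> s * s)" and \<epsilon>: "\<forall>s\<in>S. \<epsilon> s \<in> {-1, 0, 1::int}"
      using \<open>y \<in> one_span S\<close> unfolding one_span_def by blast
    have "(\<Sum>s\<in>S. (\<epsilon>(x := e)) s * s) = y"
      unfolding y using assms(2) by (intro sum.cong) auto
    then have "e * x + y = (\<Sum>s\<in>insert x S. (\<epsilon>(x := e)) s * s)"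
      using assms by simp
    moreover have "\<forall>s\<in>insert x S. (\<epsilon>(x := e)) s \<in> {-1, 0, 1}" using \<epsilon> e by auto
    ultimately show ?thesis unfolding one_span_def by blast
  qed
  fix z assume "z \<in> one_span S \<union> (\<lambda>y. x + y) ` one_span S \<union> (\<lambda>y. y - x) ` one_span S"
  then show "z \<in> one_span (insert x S)"
    using step[of _ 0] step[of _ 1] step[of _ "-1"] by auto
qed

text \<open>Each new element at most triples the span. Finiteness is carried through the induction
  because \<open>card_image_le\<close> requires it.\<close>

lemma finite_one_span_card_le:
  assumes "finite S"
  shows "finite (one_span S) \<and> card (one_span S) \<le> 3 ^ card S"
  using assms
proof induction
  case empty
  then show ?case by (simp add: one_span_empty)
next
  case (insert x S)
  let ?A = "one_span S" and ?B = "(\<lambda>y. x + y) ` one_span S" and ?C = "(\<lambda>y. y - x) ` one_span S"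
  have "card (?A \<union> ?B \<union> ?C) \<le> card ?A + card ?B + card ?C"
    by (meson add_mono card_Un_le le_refl order_trans)
  also have "\<dots> \<le> 3 * card ?A"
    using card_image_le[of ?A "\<lambda>y. x + y"] card_image_le[of ?A "\<lambda>y. y - x"] insert.IH by linarith
  finally show ?case using insert by (simp add: one_span_insert)
qed

text \<open>If two equal subset sums both use \<open>x\<close>, it cancels. If just one does,
  solving for \<open>x\<close> writes it as a difference of subset sums of \<open>S\<close>, that
  is, as an element of the span; this step is reversible.\<close>

lemma dissociated_insert_iff:
  assumes "finite S" "x \<notin> S"
  shows "dissociated (insert x S) \<longleftrightarrow> dissociated S \<and> x \<notin> one_span S"
proof (intro iffI conjI)
  assume D: "dissociated (insert x S)"
  then show "dissociated S"
    unfolding dissociated_def by (rule inj_on_subset) auto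
  show "x \<notin> one_span S"
  proof
    assume "x \<in> one_span S"
    then obtain X Y where x: "x = \<Sum>Y - \<Sum>X" and XY: "X \<subseteq> S" "Y \<subseteq> S"
      using one_span_eq_diff_subset_sums[OF assms(1)] by blast
    have "finite X" "x \<notin> X" using XY assms finite_subset by auto
    then have "\<Sum>(insert x X) = \<Sum>Y" using x by simp
    then have "insert x X = Y"
      using D XY unfolding dissociated_def inj_on_def by blast
    then show False using XY assms by blast
  qed
next
  assume D: "dissociated S \<and> x \<notin> one_span S"
  have ne: "\<Sum>X \<noteq> \<Sum>Y" if "X \<subseteq> insert x S" "Y \<subseteq> S" "x \<in> X" for X Y
  proof
    assume "\<Sum>X = \<Sum>Y"
    moreover have "\<Sum>X = x + \<Sum>(X - {x})"
      using that assms(1) by (intro sum.remove) (auto intro: finite_subset)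
    ultimately have "x = \<Sum>Y - \<Sum>(X - {x})" by simp
    moreover have "X - {x} \<subseteq> S" using that by blast
    ultimately have "x \<in> one_span S"
      unfolding one_span_eq_diff_subset_sums[OF assms(1)] using that by blast
    with D show False by blast
  qed
  show "dissociated (insert x S)"
    unfolding dissociated_def
  proof (rule inj_onI)
    fix X Y assume XY: "X \<in> Pow (insert x S)" "Y \<in> Pow (insert x S)" and eq: "\<Sum>X = \<Sum>Y"
    have fin: "finite X" "finite Y" using XY assms(1) by (auto intro: finite_subset)
    have iff: "x \<in> X \<longleftrightarrow> x \<in> Y" using ne[of X Y] ne[of Y X] XY eq by auto
    have "\<Sum>(X - {x}) = \<Sum>(Y - {x})"
      using iff eq fin by (simp add: sum_diff1)
    moreover have "X - {x} \<in> Pow S" "Y - {x} \<in> Pow S" using XY by auto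
    ultimately have "X - {x} = Y - {x}"
      using D unfolding dissociated_def by (auto dest: inj_onD)
    then show "X = Y" using iff by auto
  qed
qed

lemma dissociated_subset: "dissociated D \<Longrightarrow> S \<subseteq> D \<Longrightarrow> dissociated S"
  unfolding dissociated_def by (erule inj_on_subset) auto

text \<open>Dissociativity passes to subsets, so a proper extension exists only if a single element
  can be adjoined, which is possible exactly for elements outside the span.\<close>

lemma maximal_dissociated_iff_spanning:
  assumes "finite A"
  shows "maximal_dissociated A D \<longleftrightarrow> D \<subseteq> A \<and> dissociated D \<and> A \<subseteq> one_span D"
proof (cases "D \<subseteq> A \<and> dissociated D")
  case True
  then have fin: "finite D" using assms finite_subset by blast
  have "(\<exists>D'. D' \<subseteq> A \<and> dissociated D' \<and> D \<subset> D') \<longleftrightarrow> (\<exists>x \<in> A - D. dissociated (insert x D))"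
  proof
    assume "\<exists>D'. D' \<subseteq> A \<and> dissociated D' \<and> D \<subset> D'"
    then obtain D' x where "D' \<subseteq> A" "dissociated D'" "D \<subseteq> D'" "x \<in> D' - D" by blast
    then show "\<exists>x \<in> A - D. dissociated (insert x D)"
      using dissociated_subset[of D' "insert x D"] by blast
  next
    assume "\<exists>x \<in> A - D. dissociated (insert x D)"
    then obtain x where "x \<in> A - D" "dissociated (insert x D)" by blast
    then show "\<exists>D'. D' \<subseteq> A \<and> dissociated D' \<and> D \<subset> D'"
      using True by (intro exI[of _ "insert x D"]) auto
  qed
  also have "\<dots> \<longleftrightarrow> \<not> A \<subseteq> one_span D"
    using dissociated_insert_iff[OF fin] True subset_one_span[OF fin] by blast
  finally show ?thesis using True unfolding maximal_dissociated_def by blast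
qed (auto simp: maximal_dissociated_def)

text \<open>The span is the union of the translates of [-M, M] by -x, 0 and x. The bound
  \<open>x \<le> 2 * M + 1\<close> says that no integer is missed between M and x - M.\<close>

lemma one_span_insert_interval:
  assumes "finite S" "one_span S = {-M..M}" "M < x" "x \<le> 2 * M + 1"
  shows "one_span (insert x S) = {-(x + M)..x + M}"
proof -
  have "x \<notin> S" using subset_one_span[OF assms(1)] assms by auto
  moreover have "(\<lambda>y. y - x) ` {-M..M} = {-M - x..M - x}"
    using image_add_atLeastAtMost[of "-x" "-M" M] by simp
  ultimately have "one_span (insert x S) = {-M..M} \<union> {x - M..x + M} \<union> {-M - x..M - x}"
    using one_span_insert[OF assms(1)] by (simp add: assms(2) add.commute)
  also have "\<dots> = {-(x + M)..x + M}"
    using assms(3,4) by (intro set_eqI) (simp only: Un_iff atLeastAtMost_iff, linarith)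
  finally show ?thesis .
qed

lemma dissociated_insert_interval:
  assumes "finite S" "one_span S = {-M..M}" "M < x" "dissociated S"
  shows "dissociated (insert x S)" "x \<notin> S"
proof -
  show "x \<notin> S" using subset_one_span[OF assms(1)] assms by auto
  then show "dissociated (insert x S)" using assms by (simp add: dissociated_insert_iff)
qed

text \<open>Induction on \<open>n\<close>: with M the current radius, the next power is 2 * M + 1,
  the extreme case of the interval lemma, where the translates abut without overlapping.\<close>

lemma powers_of_3:
  fixes n :: nat
  defines "P \<equiv> \<lambda>m. (\<lambda>i. 3 ^ i :: int) ` {..<m}"
  shows "dissociated (P n) \<and> one_span (P n) = {-((3 ^ n - 1) div 2)..(3 ^ n - 1) div 2}"
proof (induction n)
  case 0
  then show ?case by (simp add: P_def one_span_empty dissociated_def)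
next
  case (Suc n)
  define M :: int where "M = (3 ^ n - 1) div 2"
  have M: "3 ^ n = 2 * M + 1" unfolding M_def by simp
  \<comment> \<open>As 0 lies in the interval [-M, M], its radius is nonnegative, whence M < 2 * M +
    1.\<close>
  have "0 \<in> one_span (P n)" by (rule zero_in_one_span)
  then have "M \<ge> 0" using Suc by (simp add: M_def)
  then have "M < 3 ^ n" "3 ^ n \<le> 2 * M + 1" using M by simp_all
  moreover have "finite (P n)" "P (Suc n) = insert (3 ^ n) (P n)"
    by (auto simp: P_def lessThan_Suc)
  moreover have "3 ^ n + M = (3 ^ Suc n - 1) div 2" using M by simp
  ultimately show ?case
    using Suc one_span_insert_interval[of "P n" M "3 ^ n"]
      dissociated_insert_interval[of "P n" M "3 ^ n"]
    by (simp only: M_def)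
qed

text \<open>By symmetry the span contains all 2 * N + 1 integers of [-N, N], while it has at most
  \<open>3 ^ card S\<close> elements.\<close>

lemma spanning_set_card:
  assumes "S \<subseteq> {1..int N}" "{1..int N} \<subseteq> one_span S"
  shows "2 * N + 1 \<le> 3 ^ card S"
proof -
  have fin: "finite S" using assms(1) finite_subset by blast
  have "{-int N..int N} \<subseteq> one_span S"
  proof
    fix z assume "z \<in> {-int N..int N}"
    then consider "z = 0" | "z \<in> {1..int N}" | "- z \<in> {1..int N}" by force
    then show "z \<in> one_span S"
      using assms(2) zero_in_one_span one_span_uminus[OF fin, of "- z"]
      by cases (blast, blast, metis minus_minus subsetD)
  qed
  then have "card {-int N..int N} \<le> 3 ^ card S"
    using finite_one_span_card_le[OF fin] card_mono le_trans by blast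
  then have "int (2 * N + 1) \<le> int (3 ^ card S)" by simp
  then show ?thesis by (simp only: of_nat_le_iff)
qed

lemma exists_spanning_dissociated:
  fixes N n :: nat
  assumes "3 ^ n < 2 * N" "2 * N \<le> 3 ^ Suc n"
  shows "\<exists>D. D \<subseteq> {1..int N} \<and> dissociated D \<and> {1..int N} \<subseteq> one_span D \<and> card D = Suc n"
proof -
  define P where "P = (\<lambda>i. 3 ^ i :: int) ` {..<n}"
  define M :: int where "M = (3 ^ n - 1) div 2"
  have M: "3 ^ n = 2 * M + 1" unfolding M_def by simp
  have P: "finite P" "dissociated P" "one_span P = {-M..M}"
    using powers_of_3[of n] by (simp_all add: P_def M_def)
  have cardP: "card P = n"
    unfolding P_def by (subst card_image) (auto simp: inj_on_def)
  have "int (3 ^ n) < int (2 * N)" "int (2 * N) \<le> int (3 ^ Suc n)"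
    using assms by (simp_all only: of_nat_less_iff of_nat_le_iff)
  \<comment> \<open>Parity sharpens the bounds 2 * M + 1 < 2 * N and 2 * N \<le> 6 * M + 3.\<close>
  then have N: "M < int N" "int N \<le> 3 * M + 1" using M by simp_all
  \<comment> \<open>The next power of 3 would be 2 * M + 1; capping it at N keeps the set inside
    [N], and x + M still reaches N in both cases.\<close>
  define x where "x = min (int N) (2 * M + 1)"
  have M0: "M \<ge> 0" using zero_in_one_span[of P] P by simp
  then have x: "M < x" "x \<le> 2 * M + 1" "x \<le> int N" "int N \<le> x + M" using N by (auto simp: x_def)
  have "P \<subseteq> {-M..M}" using subset_one_span P by blast
  moreover have "p \<ge> 1" if "p \<in> P" for p using that by (auto simp: P_def)
  ultimately have "insert x P \<subseteq> {1..int N}" using x M0 by force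
  moreover have "{1..int N} \<subseteq> one_span (insert x P)"
    using one_span_insert_interval[OF P(1,3) x(1,2)] x M0 by auto
  moreover have "dissociated (insert x P)" "card (insert x P) = Suc n"
    using dissociated_insert_interval[OF P(1,3) x(1) P(2)] P(1) cardP by auto
  ultimately show ?thesis by blast
qed

text \<open>One set attains both minima, and the same lower bound serves both, since maximal
  dissociated sets span.\<close>

lemma d_s_d_d_minus_interval:
  fixes N n :: nat
  assumes "3 ^ n < 2 * N" "2 * N \<le> 3 ^ Suc n"
  shows "d_s {1..int N} = Suc n" "d_d_minus {1..int N} = Suc n"
proof -
  obtain D where D: "D \<subseteq> {1..int N}" "dissociated D" "{1..int N} \<subseteq> one_span D" "card D = Suc n"
    using exists_spanning_dissociated[OF assms] by blast
  have lower: "Suc n \<le> card S" if "S \<subseteq> {1..int N}" "{1..int N} \<subseteq> one_span S" for S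
  proof -
    have "3 ^ n < (3 :: nat) ^ card S" using spanning_set_card[OF that] assms by linarith
    then show ?thesis by simp
  qed
  show "d_s {1..int N} = Suc n"
    unfolding d_s_def using D lower by (intro cInf_eq_minimum) (auto intro!: exI[of _ D])
  show "d_d_minus {1..int N} = Suc n"
    unfolding d_d_minus_def maximal_dissociated_iff_spanning[OF finite_atLeastAtMost_int]
    using D lower by (intro cInf_eq_minimum) (auto intro!: exI[of _ D])
qed

theorem theorem1p6:
  fixes N :: nat
  assumes "N \<ge> 1"
  shows "d_s {1..int N} = d_d_minus {1..int N} \<and>
    int (d_d_minus {1..int N}) =
      \<lfloor>log 3 (real N)\<rfloor> + \<lceil>log 3 (2 * real N) - of_int \<lfloor>log 3 (real N)\<rfloor>\<rceil>"
proof -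
  \<comment> \<open>The bracket is closed above, matching the ceiling of log_3(2N).\<close>
  obtain n where n: "3 ^ n < 2 * N" "2 * N \<le> 3 ^ (n + 1)"
    using ex_power_ivl2[of 3 "2 * N"] assms by auto
  then have "\<lceil>log (real 3) (real (2 * N))\<rceil> = int n + 1"
    using assms by (subst ceiling_log_nat_eq_powr_iff) auto
  \<comment> \<open>The integer floor term comes out of the ceiling and cancels, leaving the ceiling
    of log_3(2N), which is n + 1.\<close>
  then show ?thesis
    using d_s_d_d_minus_interval[of n N] n by simp
qed

end
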